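(* Let $\mathcal T$ be any simplicial mesh of $\Omega\subset\mathbb R^d$, let $k\ge1$, $0\le\ell\le d$, and let $\bm p\in\mathcal X_k^\ell(\mathcal T)$, with $f=\mathrm{Conv}(\bm v_0^f,\dots,\bm v_\ell^f)\in\Delta_\ell(\mathcal T)$, $\bm p\in\mathring f$ and $\bm p=\frac1k\sum_{i=0}^\ell\alpha_i\bm v_i^f$. Then the global $P_k$ Lagrange basis function $\varphi_{\bm p}$ satisfies $$\varphi_{\bm p}(\bm x)=\frac1{\bm\alpha!}\prod_{i=0}^\ell\prod_{j=0}^{\alpha_i-1}\left(k\,\phi_{\bm v_i^f}(\bm x)-j\right)\qquad\text{for all }\bm x\in\Omega,$$ where $\phi_{\bm v_i^f}$ is the continuous piecewise linear basis function of $\mathcal T$ at the vertex $\bm v_i^f$.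
   Context: $\Omega\subset\mathbb R^d$ is a bounded polytope domain. A simplicial mesh $\mathcal T=\{T_1,\dots,T_N\}$ of $\Omega$ is a finite set of (closed, nondegenerate) $d$-dimensional simplices with $\Omega=\bigcup_{T\in\mathcal T}T$ such that any two of them intersect in the empty set or in a common sub-simplex (face). $\Delta_\ell(T)$ is the set of $\ell$-dimensional sub-simplices of $T$ (convex hulls of $\ell+1$ of its vertices), and $\Delta_\ell(\mathcal T)=\bigcup_{T\in\mathcal T}\Delta_\ell(T)$. For $S\subseteq\Omega$: $I_S=\{i:S\subseteq T_i\}$ and $P_S=\bigcup_{i\in I_S}T_i$; write $I_{\bm x},P_{\bm x}$ when $S=\{\bm x\}$. For a simplex $T=\mathrm{Conv}(\bm v_0,\dots,\bm v_d)$ the barycentric coordinate functions $\lambda_0,\dots,\lambda_d$ are the affine functions with $\sum_i\lambda_i=1$ and $\bm x=\sum_i\lambda_i(\bm x)\bm v_i$; for $T=T_s$ they are written $\lambda_{s,i}$. $\mathcal X_k(T)=\{\frac1k\sum_{i=0}^d\alpha_i\bm v_i:\bm\alpha\in\mathbb N^{d+1},\ |\bm\alpha|=\sum_i\alpha_i=k\}$ (with $0\in\mathbb N$), and $\mathcal X_k(\mathcal T)=\bigcup_T\mathcal X_k(T)$. $\mathring f$ is the relative interior of a sub-simplex $f$ ($\mathring f=f$ if $f$ is a vertex), and $\mathcal X_k^\ell(\mathcal T)$ is the set of points of $\mathcal X_k(\mathcal T)$ lying in $\mathring f$ for some $f\in\Delta_\ell(\mathcal T)$. For such $\bm p\in\mathring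 f$, $f=\mathrm{Conv}(\bm v^f_0,\dots,\bm v^f_\ell)$, there are unique positive integers $\alpha_0,\dots,\alpha_\ell$ with $\sum_i\alpha_i=k$ and $\bm p=\frac1k\sum_i\alpha_i\bm v_i^f$; also $I_{\bm p}=I_f$. For each $s\in I_{\bm p}$ the vertices of $T_s$ are ordered (indices $0,\dots,d$) so that vertices $0,\dots,\ell$ are $\bm v_0^f,\dots,\bm v_\ell^f$; thus in each $T_s$ the point $\bm p$ has index $\bm\alpha=(\alpha_0,\dots,\alpha_\ell,0,\dots,0)$, and $\bm\alpha!=\prod_i\alpha_i!$. The global $P_k$ Lagrange basis function $\varphi_{\bm p}$ is: $\varphi_{\bm p}(\bm x)=0$ if $\bm x\notin P_{\bm p}$, and $\varphi_{\bm p}(\bm x)=\frac{1}{\bm\alpha!}\prod_{i=0}^{d}\prod_{j=0}^{\alpha_i-1}(k\lambda_{s,i}(\bm x)-j)$ if $\bm x\in T_s$, $s\in I_{\bm p}$. (Empty products equal 1.) For a vertex $\bm v\in\Delta_0(\mathcal T)$, $\phi_{\bm v}(\bm x)=\lambda_{s,j}(\bm x)$ if $\bm x\in T_s$ with $s\in I_{\bm v}$ and $\bm v$ the $j$-th vertex of $T_s$, and $\phi_{\bm v}(\bm x)=0$ if $\bm x\notin P_{\bm v}$. *)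

theory Defs
  imports "HOL-Analysis.Analysis"
begin

section \<open>Simplices and simplicial meshes\<close>

text \<open>A simplex is represented by its point set, and its vertices are its extreme points.
  Barycentric coordinates and multi-indices are indexed by the vertices themselves rather
  than by an enumeration of them; all sums and products below run over the vertex set, so
  no ordering of the vertices has to be chosen.\<close>

definition vertices :: "(real^'d) set \<Rightarrow> (real^'d) set" where
  "vertices T = {v. v extreme_point_of T}"

definition sub_simplices :: "nat \<Rightarrow> (real^'d) set \<Rightarrow> (real^'d) set set" where
  "sub_simplices l T = {convex hull V | V. V \<subseteq> vertices T \<and> card V = l + 1}"

definition mesh_sub_simplices :: "nat \<Rightarrow> (real^'d) set set \<Rightarrow> (real^'d) set set" where
  "mesh_sub_simplices l \<T> = (\<Union>T\<in>\<T>. sub_simplices l T)"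

text \<open>Since a mesh covers \<open>\<Omega>\<close> by closed simplices, \<open>\<Omega>\<close> is the closure of a domain
  (a nonempty connected open set). It need not be convex, so it is a finite union of
  polytopes in the (convex) sense of the library.\<close>

definition polytope_domain :: "(real^'d) set \<Rightarrow> bool" where
  "polytope_domain \<Omega> \<longleftrightarrow>
     (\<exists>U. open U \<and> connected U \<and> U \<noteq> {} \<and> bounded U \<and> \<Omega> = closure U) \<and>
     (\<exists>\<P>. finite \<P> \<and> (\<forall>P\<in>\<P>. polytope P) \<and> \<Omega> = \<Union>\<P>)"

definition simplicial_mesh :: "(real^'d) set set \<Rightarrow> (real^'d) set \<Rightarrow> bool" where
  "simplicial_mesh \<T> \<Omega> \<longleftrightarrow>
     finite \<T> \<and>
     (\<forall>T\<in>\<T>. int CARD('d) simplex T) \<and>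
     \<Omega> = \<Union>\<T> \<and>
     (\<forall>T\<in>\<T>. \<forall>T'\<in>\<T>. T \<inter> T' = {} \<or> (\<exists>l. T \<inter> T' \<in> sub_simplices l T \<inter> sub_simplices l T'))"

text \<open>The index set \<open>I\<^sub>S\<close> is rendered as the set of the simplices it indexes.\<close>

definition star :: "(real^'d) set set \<Rightarrow> (real^'d) set \<Rightarrow> (real^'d) set set" where
  "star \<T> S = {T \<in> \<T>. S \<subseteq> T}"

definition patch :: "(real^'d) set set \<Rightarrow> (real^'d) set \<Rightarrow> (real^'d) set" where
  "patch \<T> S = \<Union>(star \<T> S)"


section \<open>Barycentric coordinates and lattice points\<close>

text \<open>\<open>barycentric T v\<close> is the barycentric coordinate function of \<open>T\<close> at its vertex \<open>v\<close>,
  defined on the whole space. The value \<open>0\<close> at non-vertices only serves to make the family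
  unique; affinity of a function \<open>g\<close> is expressed as linearity of \<open>g - g 0\<close>.\<close>

definition barycentric :: "(real^'d) set \<Rightarrow> real^'d \<Rightarrow> real^'d \<Rightarrow> real" where
  "barycentric T = (THE lam.
     (\<forall>v. v \<notin> vertices T \<longrightarrow> lam v = (\<lambda>x. 0)) \<and>
     (\<forall>v\<in>vertices T. linear (\<lambda>x. lam v x - lam v 0)) \<and>
     (\<forall>x. (\<Sum>v\<in>vertices T. lam v x) = 1) \<and>
     (\<forall>x. x = (\<Sum>v\<in>vertices T. lam v x *\<^sub>R v)))"

definition lattice_index :: "nat \<Rightarrow> (real^'d) set \<Rightarrow> real^'d \<Rightarrow> (real^'d \<Rightarrow> nat) \<Rightarrow> bool" where
  "lattice_index k T p \<alpha> \<longleftrightarrow>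
     (\<forall>v. v \<notin> vertices T \<longrightarrow> \<alpha> v = 0) \<and>
     (\<Sum>v\<in>vertices T. \<alpha> v) = k \<and>
     p = (1 / real k) *\<^sub>R (\<Sum>v\<in>vertices T. real (\<alpha> v) *\<^sub>R v)"

definition lattice_points :: "nat \<Rightarrow> (real^'d) set \<Rightarrow> (real^'d) set" where
  "lattice_points k T = {p. \<exists>\<alpha>. lattice_index k T p \<alpha>}"

definition mesh_lattice_points :: "nat \<Rightarrow> (real^'d) set set \<Rightarrow> (real^'d) set" where
  "mesh_lattice_points k \<T> = (\<Union>T\<in>\<T>. lattice_points k T)"

definition mesh_lattice_points_dim :: "nat \<Rightarrow> nat \<Rightarrow> (real^'d) set set \<Rightarrow> (real^'d) set" where
  "mesh_lattice_points_dim k l \<T> =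
     {p \<in> mesh_lattice_points k \<T>. \<exists>f\<in>mesh_sub_simplices l \<T>. p \<in> rel_interior f}"

definition multi_index :: "nat \<Rightarrow> (real^'d) set \<Rightarrow> real^'d \<Rightarrow> real^'d \<Rightarrow> nat" where
  "multi_index k T p = (THE \<alpha>. lattice_index k T p \<alpha>)"


section \<open>Basis functions\<close>

text \<open>The two global functions are given simplex by simplex. The definite description below
  picks the common value at \<open>x\<close> over all simplices of the star that contain \<open>x\<close>;
  it is uninformative unless these values agree.\<close>

definition local_lagrange :: "nat \<Rightarrow> (real^'d) set \<Rightarrow> real^'d \<Rightarrow> real^'d \<Rightarrow> real" where
  "local_lagrange k T p x =
     1 / (\<Prod>v\<in>vertices T. fact (multi_index k T p v)) *
     (\<Prod>v\<in>vertices T. \<Prod>j<multi_index k T p v. (real k * barycentric T v x - real j))"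

definition lagrange_basis :: "(real^'d) set set \<Rightarrow> nat \<Rightarrow> real^'d \<Rightarrow> real^'d \<Rightarrow> real" where
  "lagrange_basis \<T> k p x =
     (if x \<in> patch \<T> {p}
      then (THE y. \<exists>T\<in>star \<T> {p}. x \<in> T \<and> y = local_lagrange k T p x)
      else 0)"

definition hat_function :: "(real^'d) set set \<Rightarrow> real^'d \<Rightarrow> real^'d \<Rightarrow> real" where
  "hat_function \<T> v x =
     (if x \<in> patch \<T> {v}
      then (THE y. \<exists>T\<in>star \<T> {v}. x \<in> T \<and> y = barycentric T v x)
      else 0)"

end

theory Submission
  imports Defs
begin

text \<open>On the intersection of two mesh simplices, which is a common face, the barycentric
  coordinates of both simplices restrict to those of the face, and the coordinates at the
  remaining vertices vanish. Hence \<open>hat_function \<T> v x = barycentric T v x\<close> for \<^emph>\<open>every\<close> mesh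
  simplex \<open>T\<close> containing \<open>x\<close>, whether or not \<open>v\<close> is a vertex of \<open>T\<close>. On the patch of \<open>p\<close> the
  claim thus holds simplex by simplex, because \<open>\<alpha>\<close> is the multi-index of \<open>p\<close> in each simplex of
  the star. Off the patch, some \<open>v i\<close> is missing from the simplex containing \<open>x\<close>, and the factor
  with \<open>j = 0\<close> at this vertex vanishes.\<close>

section \<open>Simplices and their vertices\<close>

lemma vertices_convex_hull:
  fixes C :: "(real^'d) set"
  assumes "\<not> affine_dependent C"
  shows "vertices (convex hull C) = C"
  using extreme_point_of_convex_hull_affine_independent[OF assms] by (auto simp: vertices_def)

lemma vertices_subset: "vertices T \<subseteq> T"
  by (auto simp: vertices_def extreme_point_of_def)

lemma simplex_vertices:
  fixes T :: "(real^'d) set"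
  assumes "n simplex T"
  shows "\<not> affine_dependent (vertices T)" "T = convex hull (vertices T)"
    "int (card (vertices T)) = n + 1"
  using assms by (auto simp: simplex vertices_convex_hull)

lemma finite_vertices_simplex:
  fixes T :: "(real^'d) set"
  assumes "n simplex T"
  shows "finite (vertices T)"
  using aff_independent_finite simplex_vertices(1)[OF assms] by blast

section \<open>Barycentric coordinates\<close>

text \<open>Otherwise \<open>a - b\<close> would be a nontrivial affine dependence: its coefficients
  sum to 0 and so does its weighted sum of points.\<close>

lemma affine_independent_coeffs_unique:
  fixes a b :: "'a::real_vector \<Rightarrow> real"
  assumes "\<not> affine_dependent C" "finite C" "sum a C = sum b C"
    "(\<Sum>v\<in>C. a v *\<^sub>R v) = (\<Sum>v\<in>C. b v *\<^sub>R v)" "v \<in> C"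
  shows "a v = b v"
proof (rule ccontr)
  assume "a v \<noteq> b v"
  moreover have "sum (\<lambda>w. a w - b w) C = 0"
    using assms by (simp add: sum_subtractf)
  moreover have "(\<Sum>w\<in>C. (a w - b w) *\<^sub>R w) = 0"
    using assms by (simp add: scaleR_diff_left sum_subtractf)
  ultimately have "affine_dependent C"
    unfolding affine_dependent_explicit_finite[OF \<open>finite C\<close>] using \<open>v \<in> C\<close>
    by (intro exI[of _ "\<lambda>w. a w - b w"]) auto
  with assms show False by blast
qed

text \<open>Justifies the definite description. Coefficients exist because the vertices span the
  space affinely; their uniqueness at each point yields both affinity in \<open>x\<close> and
  uniqueness of the family.\<close>

lemma barycentric_spec:
  fixes T :: "(real^'d) set"
  assumes T: "int CARD('d) simplex T"
  shows "(\<forall>v. v \<notin> vertices T \<longrightarrow> barycentric T v = (\<lambda>x. 0)) \<and>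
     (\<forall>v\<in>vertices T. linear (\<lambda>x. barycentric T v x - barycentric T v 0)) \<and>
     (\<forall>x. (\<Sum>v\<in>vertices T. barycentric T v x) = 1) \<and>
     (\<forall>x. x = (\<Sum>v\<in>vertices T. barycentric T v x *\<^sub>R v))"
proof -
  let ?C = "vertices T"
  let ?P = "\<lambda>lam. (\<forall>v. v \<notin> ?C \<longrightarrow> lam v = (\<lambda>x. 0)) \<and>
     (\<forall>v\<in>?C. linear (\<lambda>x. lam v x - lam v 0)) \<and>
     (\<forall>x. (\<Sum>v\<in>?C. lam v x) = 1) \<and>
     (\<forall>x. x = (\<Sum>v\<in>?C. lam v x *\<^sub>R v))"
  note aff = simplex_vertices(1)[OF T] and fin = finite_vertices_simplex[OF T]
  note unique = affine_independent_coeffs_unique[OF aff fin]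
  \<comment> \<open>The d+1 affinely independent vertices have affine dimension d.\<close>
  have "aff_dim ?C = int DIM(real^'d)"
    using aff_dim_affine_independent[OF aff] simplex_vertices(3)[OF T] by simp
  then have "affine hull ?C = UNIV"
    using aff_dim_eq_full by blast
  then have "\<forall>x. \<exists>u. sum u ?C = 1 \<and> (\<Sum>v\<in>?C. u v *\<^sub>R v) = x"
    unfolding affine_hull_finite[OF fin] by blast
  then obtain u where u: "\<And>x. sum (u x) ?C = 1" "\<And>x. (\<Sum>v\<in>?C. u x v *\<^sub>R v) = x"
    by metis
  define lam where "lam v x = (if v \<in> ?C then u x v else 0)" for v x
  have "linear (\<lambda>x. u x v - u 0 v)" if v: "v \<in> ?C" for v
  proof (rule linearI)
    fix x y :: "real^'d" and r :: real
    \<comment> \<open>Both sides are coefficients of \<open>x + y\<close>: the family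
      \<open>u 0\<close> represents the origin, and subtracting it corrects the total to 1 + 1 - 1 =
      1.\<close>
    have "u (x + y) v = u x v + u y v - u 0 v"
      by (rule unique[OF _ _ v])
        (simp_all add: u sum_subtractf sum.distrib scaleR_diff_left scaleR_add_left)
    then show "u (x + y) v - u 0 v = (u x v - u 0 v) + (u y v - u 0 v)" by simp
    have *: "(\<Sum>v\<in>?C. (r * u z v) *\<^sub>R v) = r *\<^sub>R z" for z
      using u(2)[of z] by (metis (mono_tags, lifting) scaleR_scaleR scaleR_sum_right sum.cong)
    \<comment> \<open>Again \<open>u 0\<close> adds nothing to the represented point and adjusts the
      total to r - r + 1 = 1.\<close>
    have "u (r *\<^sub>R x) v = r * u x v - r * u 0 v + u 0 v"
      by (rule unique[OF _ _ v])
        (simp_all add: u * sum_subtractf sum.distrib scaleR_diff_left scaleR_add_left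
          flip: sum_distrib_left)
    then show "u (r *\<^sub>R x) v - u 0 v = r *\<^sub>R (u x v - u 0 v)" by (simp add: algebra_simps)
  qed
  then have ex: "?P lam"
    using u by (auto simp: lam_def)
  have "lam' = lam" if "?P lam'" for lam'
  proof (intro ext)
    fix v x
    show "lam' v x = lam v x"
    proof (cases "v \<in> ?C")
      case True
      have "(\<Sum>v\<in>?C. lam' v x) = (\<Sum>v\<in>?C. lam v x)"
        using that ex by simp
      moreover have "(\<Sum>v\<in>?C. lam' v x *\<^sub>R v) = x" "(\<Sum>v\<in>?C. lam v x *\<^sub>R v) = x"
        using that ex by simp_all
      ultimately show ?thesis
        using unique[where a = "\<lambda>v. lam' v x" and b = "\<lambda>v. lam v x", OF _ _ True] by simp
    qed (use that ex in simp)
  qed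
  then show ?thesis
    unfolding barycentric_def using theI[of ?P, OF ex] by blast
qed

text \<open>Reads coordinates off a representation over a face: \<open>u\<close> extended by zero
  represents \<open>x\<close> over all vertices of \<open>T\<close>, so uniqueness applies.\<close>

lemma barycentric_eqI:
  fixes T :: "(real^'d) set"
  assumes T: "int CARD('d) simplex T"
    and V: "V \<subseteq> vertices T" and u: "sum u V = 1" "(\<Sum>v\<in>V. u v *\<^sub>R v) = x"
  shows "barycentric T w x = (if w \<in> V then u w else 0)"
proof (cases "w \<in> vertices T")
  case True
  let ?u = "\<lambda>w. if w \<in> V then u w else 0"
  note fin = finite_vertices_simplex[OF T]
  have "sum ?u (vertices T) = sum u V"
    using V fin by (intro sum.mono_neutral_cong_right) auto
  moreover have "(\<Sum>v\<in>vertices T. ?u v *\<^sub>R v) = (\<Sum>v\<in>V. u v *\<^sub>R v)"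
    using V fin by (intro sum.mono_neutral_cong_right) auto
  moreover have "(\<Sum>v\<in>vertices T. barycentric T v x) = 1"
    "(\<Sum>v\<in>vertices T. barycentric T v x *\<^sub>R v) = x"
    using barycentric_spec[OF T] by simp_all
  ultimately show ?thesis
    using u affine_independent_coeffs_unique[OF simplex_vertices(1)[OF T] fin _ _ True,
      of "\<lambda>w. barycentric T w x" ?u] by simp
next
  case False
  then show ?thesis
    using barycentric_spec[OF T] V by (auto simp: fun_eq_iff)
qed

section \<open>Hat functions on the mesh\<close>

text \<open>The common face has the same vertex set seen from \<open>T\<close> and from
  \<open>T'\<close>, since vertices are the extreme points of the point set. Both coordinate
  families then extend the same coefficients by zero.\<close>

lemma barycentric_agree:
  assumes mesh: "simplicial_mesh \<T> \<Omega>" and TT: "T \<in> \<T>" "T' \<in> \<T>" and x: "x \<in> T" "x \<in> T'"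
  shows "barycentric T v x = barycentric T' v x"
proof -
  have simp: "int CARD('a) simplex T" "int CARD('a) simplex T'"
    using mesh TT by (auto simp: simplicial_mesh_def)
  obtain m where "T \<inter> T' \<in> sub_simplices m T \<inter> sub_simplices m T'"
    using mesh TT x unfolding simplicial_mesh_def by blast
  then obtain W W' where W: "T \<inter> T' = convex hull W" "W \<subseteq> vertices T"
    and W': "T \<inter> T' = convex hull W'" "W' \<subseteq> vertices T'"
    by (auto simp: sub_simplices_def)
  have "\<not> affine_dependent W" "\<not> affine_dependent W'"
    using W W' simplex_vertices(1) simp affine_independent_subset by blast+
  then have [simp]: "W' = W"
    using W(1) W'(1) vertices_convex_hull by metis
  have "finite W"
    using W(2) finite_vertices_simplex[OF simp(1)] finite_subset by blast
  moreover have "x \<in> convex hull W"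
    using W(1) x by blast
  ultimately obtain u where "sum u W = 1" "(\<Sum>w\<in>W. u w *\<^sub>R w) = x"
    by (auto simp: convex_hull_finite)
  then show ?thesis
    using barycentric_eqI[OF simp(1) W(2)] barycentric_eqI[OF simp(2)] W'(2) by simp
qed

lemma hat_function_eq_barycentric:
  assumes mesh: "simplicial_mesh \<T> \<Omega>" and T: "T \<in> \<T>" "x \<in> T"
  shows "hat_function \<T> v x = barycentric T v x"
proof (cases "x \<in> patch \<T> {v}")
  case True
  then have "\<exists>T'\<in>star \<T> {v}. x \<in> T'"
    by (auto simp: patch_def)
  moreover have "barycentric T' v x = barycentric T v x" if "T' \<in> star \<T> {v}" "x \<in> T'" for T'
    using that T by (intro barycentric_agree[OF mesh]) (auto simp: star_def)
  ultimately show ?thesis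
    using True unfolding hat_function_def by (auto intro!: the_equality)
next
  case False
  \<comment> \<open>A vertex \<open>v\<close> of \<open>T\<close> would put \<open>T\<close> into
    the star of \<open>v\<close>, and hence \<open>x\<close> into the patch.\<close>
  then have "v \<notin> vertices T"
    using T vertices_subset by (auto simp: patch_def star_def)
  moreover have "int CARD('a) simplex T"
    using mesh T by (auto simp: simplicial_mesh_def)
  ultimately show ?thesis
    using False barycentric_spec[of T] by (simp add: hat_function_def)
qed

section \<open>Multi-indices and enumerated faces\<close>

text \<open>An index divided by \<open>k\<close> is the family of barycentric coordinates of
  \<open>p\<close>, so \<open>p\<close> determines it.\<close>

lemma multi_index_eqI:
  fixes T :: "(real^'d) set"
  assumes T: "int CARD('d) simplex T" and k: "k > 0" and \<alpha>: "lattice_index k T p \<alpha>"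
  shows "multi_index k T p = \<alpha>"
proof -
  have *: "real (\<beta> v) / real k = barycentric T v p" if \<beta>: "lattice_index k T p \<beta>" for \<beta> v
  proof -
    have "(\<Sum>v\<in>vertices T. real (\<beta> v)) = real k"
      using \<beta> by (simp add: lattice_index_def flip: of_nat_sum)
    then have "(\<Sum>v\<in>vertices T. real (\<beta> v) / real k) = 1"
      using k by (simp flip: sum_divide_distrib)
    moreover have "(\<Sum>v\<in>vertices T. (real (\<beta> v) / real k) *\<^sub>R v) = p"
      using \<beta> by (simp add: lattice_index_def scaleR_sum_right)
    ultimately have "barycentric T v p = (if v \<in> vertices T then real (\<beta> v) / real k else 0)"
      by (intro barycentric_eqI[OF T]) auto
    then show ?thesis
      using \<beta> by (auto simp: lattice_index_def)
  qed
  show ?thesis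
    unfolding multi_index_def
  proof (rule the_equality, fact \<alpha>, rule ext)
    fix \<beta> v
    assume "lattice_index k T p \<beta>"
    then have "real (\<beta> v) / real k = real (\<alpha> v) / real k"
      using *[OF \<alpha>] * by simp
    then show "\<beta> v = \<alpha> v" using k by simp
  qed
qed

text \<open>The l+1 vertices of the face are extreme points of the hull, hence occur among the
  \<open>v i\<close>. As only l+1 points are listed, they are exactly these vertices, without
  repetition.\<close>

lemma sub_simplex_enumeration:
  fixes v :: "nat \<Rightarrow> real^'d"
  assumes T: "n simplex T" and f: "convex hull (v ` {0..l}) \<in> sub_simplices l T"
  shows "inj_on v {0..l}" "v ` {0..l} \<subseteq> vertices T"
proof -
  obtain V where V: "convex hull (v ` {0..l}) = convex hull V" "V \<subseteq> vertices T" "card V = l + 1"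
    using f by (auto simp: sub_simplices_def)
  have "\<not> affine_dependent V"
    using V(2) simplex_vertices(1)[OF T] affine_independent_subset by blast
  then have "V = vertices (convex hull (v ` {0..l}))"
    using V(1) vertices_convex_hull by metis
  then have sub: "V \<subseteq> v ` {0..l}"
    using extreme_point_of_convex_hull by (auto simp: vertices_def)
  moreover have "card (v ` {0..l}) \<le> l + 1"
    using card_image_le[of "{0..l}" v] by simp
  ultimately have eq: "V = v ` {0..l}"
    using V(3) by (intro card_seteq) auto
  then show "v ` {0..l} \<subseteq> vertices T" using V by simp
  show "inj_on v {0..l}"
    using V(3) eq by (intro eq_card_imp_inj_on) auto
qed

section \<open>The product formula\<close>

theorem theorem3p2:
  fixes \<Omega> :: "(real^'d) set" and \<T> :: "(real^'d) set set"
    and k l :: nat and p :: "real^'d" and f :: "(real^'d) set"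
    and v :: "nat \<Rightarrow> real^'d" and \<alpha> :: "nat \<Rightarrow> nat"
  assumes "polytope_domain \<Omega>"
    and "simplicial_mesh \<T> \<Omega>"
    and "k \<ge> 1"
    and "l \<le> CARD('d)"
    and "p \<in> mesh_lattice_points_dim k l \<T>"
    and "f \<in> mesh_sub_simplices l \<T>"
    and "f = convex hull (v ` {0..l})"
    and "p \<in> rel_interior f"
    and "\<forall>i\<in>{0..l}. \<alpha> i > 0"
    and "(\<Sum>i=0..l. \<alpha> i) = k"
    and "p = (1 / real k) *\<^sub>R (\<Sum>i=0..l. real (\<alpha> i) *\<^sub>R v i)"
  shows "\<forall>x\<in>\<Omega>. lagrange_basis \<T> k p x =
           1 / (\<Prod>i=0..l. fact (\<alpha> i)) *
           (\<Prod>i=0..l. \<Prod>j<\<alpha> i. (real k * hat_function \<T> (v i) x - real j))"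
proof
  note mesh = assms(2) and k = assms(3) and pos = assms(9) and sum_\<alpha> = assms(10) and p = assms(11)
  fix x assume "x \<in> \<Omega>"
  then obtain S where S: "S \<in> \<T>" "x \<in> S"
    using mesh by (auto simp: simplicial_mesh_def)
  have simp: "int CARD('d) simplex T" if "T \<in> \<T>" for T
    using mesh that by (simp add: simplicial_mesh_def)
  obtain T0 where T0: "T0 \<in> \<T>" and f: "convex hull (v ` {0..l}) \<in> sub_simplices l T0"
    using assms(6,7) by (auto simp: mesh_sub_simplices_def)
  note inj = sub_simplex_enumeration(1)[OF simp[OF T0] f]
    and sub = sub_simplex_enumeration(2)[OF simp[OF T0] f]
  \<comment> \<open>Moves the multi-index from positions \<open>i\<close> to the points
    \<open>v i\<close>, the form used by \<open>lattice_index\<close>; it is 0 away from the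
    vertices of \<open>f\<close>.\<close>
  define a where "a = (\<lambda>w. if w \<in> v ` {0..l} then \<alpha> (the_inv_into {0..l} v w) else 0)"
  have a: "a (v i) = \<alpha> i" if "i \<in> {0..l}" for i
    using that by (simp add: a_def the_inv_into_f_f[OF inj])
  have a_pos: "a w > 0 \<longleftrightarrow> w \<in> v ` {0..l}" for w
    using a pos by (auto simp: a_def)
  have "p \<in> convex hull (v ` {0..l})"
    using assms(7,8) rel_interior_subset by blast
  then have p_T0: "p \<in> T0"
    using simplex_vertices(2)[OF simp[OF T0]] sub hull_mono by blast
  have "(\<Sum>w\<in>v ` {0..l}. real (a w)) = (\<Sum>i=0..l. real (\<alpha> i))"
    unfolding sum.reindex[OF inj] by (intro sum.cong) (simp_all add: a)
  also have "\<dots> = real k"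
    by (simp flip: sum_\<alpha>)
  finally have "(\<Sum>w\<in>v ` {0..l}. real (a w) / real k) = 1"
    using k by (simp flip: sum_divide_distrib)
  moreover have sum_p: "(\<Sum>w\<in>v ` {0..l}. real (a w) *\<^sub>R w) = (\<Sum>i=0..l. real (\<alpha> i) *\<^sub>R v i)"
    unfolding sum.reindex[OF inj] by (intro sum.cong) (simp_all add: a)
  then have "(\<Sum>w\<in>v ` {0..l}. (real (a w) / real k) *\<^sub>R w) = p"
    by (simp add: p scaleR_sum_right flip: sum_p)
  ultimately have bary_p: "barycentric T0 w p = (if w \<in> v ` {0..l} then real (a w) / real k else 0)" for w
    by (intro barycentric_eqI[OF simp[OF T0] sub])
  \<comment> \<open>Every simplex containing \<open>p\<close> has all vertices of \<open>f\<close>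
    among its own: the coordinates of \<open>p\<close> there are positive and are the same in
    \<open>T\<close> as in \<open>T0\<close>, while \<open>barycentric T w\<close> is zero for a
    non-vertex \<open>w\<close>.\<close>
  have sub_T: "v ` {0..l} \<subseteq> vertices T" if T: "T \<in> \<T>" "p \<in> T" for T
  proof
    fix w assume w: "w \<in> v ` {0..l}"
    then have "barycentric T w p > 0"
      using bary_p barycentric_agree[OF mesh T(1) T0 T(2) p_T0] a_pos k by simp
    then show "w \<in> vertices T"
      using barycentric_spec[OF simp[OF T(1)]] by force
  qed
  have mi: "multi_index k T p = a" if T: "T \<in> \<T>" "p \<in> T" for T
  proof (rule multi_index_eqI[OF simp[OF T(1)]])
    note fin = finite_vertices_simplex[OF simp[OF T(1)]]
    have "(\<Sum>w\<in>vertices T. a w) = (\<Sum>w\<in>v ` {0..l}. a w)"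
      using fin sub_T[OF T] by (intro sum.mono_neutral_right) (auto simp: a_def)
    also have "\<dots> = (\<Sum>i=0..l. \<alpha> i)"
      unfolding sum.reindex[OF inj] by (intro sum.cong) (simp_all add: a)
    finally have "(\<Sum>w\<in>vertices T. a w) = k" using sum_\<alpha> by simp
    moreover have "(\<Sum>w\<in>vertices T. real (a w) *\<^sub>R w) = (\<Sum>w\<in>v ` {0..l}. real (a w) *\<^sub>R w)"
      using fin sub_T[OF T] by (intro sum.mono_neutral_right) (auto simp: a_def)
    ultimately show "lattice_index k T p a"
      using sub_T[OF T] p sum_p by (auto simp: lattice_index_def a_def)
  qed (use k in simp)
  let ?R = "1 / (\<Prod>i=0..l. fact (\<alpha> i)) *
    (\<Prod>i=0..l. \<Prod>j<\<alpha> i. (real k * hat_function \<T> (v i) x - real j))"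
  have local: "local_lagrange k T p x = ?R" if T: "T \<in> \<T>" "p \<in> T" "x \<in> T" for T
  proof -
    note fin = finite_vertices_simplex[OF simp[OF T(1)]]
    \<comment> \<open>Covers the factorials and the inner products at once: vertices outside
      \<open>f\<close> have index 0 and contribute 0! = 1 or an empty product.\<close>
    have *: "(\<Prod>w\<in>vertices T. g (a w) w) = (\<Prod>i=0..l. g (\<alpha> i) (v i))"
      if "\<And>w. g 0 w = 1" for g :: "nat \<Rightarrow> real^'d \<Rightarrow> real"
    proof -
      have "(\<Prod>w\<in>vertices T. g (a w) w) = (\<Prod>w\<in>v ` {0..l}. g (a w) w)"
        using fin sub_T[OF T(1,2)] that by (intro prod.mono_neutral_right) (auto simp: a_def)
      also have "\<dots> = (\<Prod>i=0..l. g (\<alpha> i) (v i))"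
        unfolding prod.reindex[OF inj] by (intro prod.cong) (simp_all add: a)
      finally show ?thesis .
    qed
    show ?thesis
      unfolding local_lagrange_def mi[OF T(1,2)] hat_function_eq_barycentric[OF mesh T(1,3)]
      using *[of "\<lambda>n w. fact n"]
        *[of "\<lambda>n w. \<Prod>j<n. (real k * barycentric T w x - real j)"] by simp
  qed
  show "lagrange_basis \<T> k p x = ?R"
  proof (cases "x \<in> patch \<T> {p}")
    case True
    then have "\<exists>T\<in>star \<T> {p}. x \<in> T"
      by (auto simp: patch_def)
    \<comment> \<open>The description is well defined because every admissible simplex gives the
      same value \<open>?R\<close>.\<close>
    then have "(THE y. \<exists>T\<in>star \<T> {p}. x \<in> T \<and> y = local_lagrange k T p x) = ?R"
      using local by (intro the_equality) (auto simp: star_def)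
    then show ?thesis
      using True by (simp add: lagrange_basis_def)
  next
    case False
    then have "p \<notin> S"
      using S by (auto simp: patch_def star_def)
    moreover have "convex S"
      using simplex_vertices(2)[OF simp[OF S(1)]] convex_convex_hull by metis
    \<comment> \<open>If the convex set \<open>S\<close> contained all \<open>v i\<close>, it would
      contain their hull and thus \<open>p\<close>.\<close>
    ultimately have "\<not> v ` {0..l} \<subseteq> S"
      using \<open>p \<in> convex hull (v ` {0..l})\<close> hull_minimal by blast
    then obtain i where i: "i \<in> {0..l}" "v i \<notin> vertices S"
      using vertices_subset by blast
    then have "hat_function \<T> (v i) x = 0"
      using hat_function_eq_barycentric[OF mesh S] barycentric_spec[OF simp[OF S(1)]] by simp
    \<comment> \<open>Since \<open>\<alpha> i\<close> is positive, \<open>j = 0\<close> is in range,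
      and its factor is \<open>k\<close> times the vanishing hat function.\<close>
    then have "(\<Prod>j<\<alpha> i. (real k * hat_function \<T> (v i) x - real j)) = 0"
      using pos i(1) by (intro prod_zero) auto
    then have "(\<Prod>i=0..l. \<Prod>j<\<alpha> i. (real k * hat_function \<T> (v i) x - real j)) = 0"
      using i(1) by (intro prod_zero) auto
    then show ?thesis
      using False by (simp add: lagrange_basis_def)
  qed
qed

end
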